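(* Let $G$ be a topological group and let $T_1, T_2, \dots \subseteq G$ be subsets that are locally cofinite at $0$. For a subset $A\subseteq G$ write $A' = A\cup\{0\}$. Then for every integer $n>0$ the set $E'_n := T'_1+\cdots+T'_n = \{a_1+\cdots+a_n : a_i\in T'_i\}$ is compact.
   Context: A topological group $\langle G,0,+,-\rangle$ is a group, written additively but not assumed abelian, equipped with a Hausdorff topology for which addition and additive inverse are continuous. A subset $T\subseteq G$ is called locally cofinite at $0$ if (1) $0\notin T$, and (2) for every open neighborhood $u$ of $0$, the set $T\setminus u$ is finite. *)

theory Defs
  imports Complex_Main
begin

definition locally_cofinite_at_0 :: "'a::{zero,topological_space} set \<Rightarrow> bool" where
  "locally_cofinite_at_0 T \<longleftrightarrow>
     0 \<notin> T \<and> (\<forall>u. open u \<and> 0 \<in> u \<longrightarrow> finite (T - u))"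

definition adjoin_0 :: "'a::zero set \<Rightarrow> 'a set" where
  "adjoin_0 A = A \<union> {0}"

text \<open>
  The group need not be abelian, so \<open>a\<^sub>1 + \<dots> + a\<^sub>n\<close> is the sum of the list
  of the \<open>a\<^sub>i\<close> in increasing order of the index; \<open>T 0\<close> is not used.
\<close>

definition sumset' :: "(nat \<Rightarrow> 'a::monoid_add set) \<Rightarrow> nat \<Rightarrow> 'a set" where
  "sumset' T n =
     {sum_list (map a [1..<Suc n]) | a. \<forall>i\<in>{1..n}. a i \<in> adjoin_0 (T i)}"

end

theory Submission
  imports Defs "HOL-Analysis.Elementary_Topology"
begin

text \<open>Each T'_i is compact because a neighborhood of 0 already contains all but finitely many
  of its points (\<open>compact_adjoin_0\<close>). Addition is continuous, and finite products and
  continuous images of compact sets are compact. So compactness passes from E'_n and T'_{n+1} to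
  their sum E'_{n+1} (\<open>sumset'_Suc\<close>), and induction on the number of summands finishes
  the proof.\<close>

lemma compact_adjoin_0:
  fixes A :: "'a::{zero,topological_space} set"
  assumes "locally_cofinite_at_0 A"
  shows "compact (adjoin_0 A)"
proof (rule compactI)
  fix C :: "'a set set"
  assume op: "\<forall>u\<in>C. open u" and cov: "adjoin_0 A \<subseteq> \<Union>C"
  then obtain u where u: "u \<in> C" "0 \<in> u"
    by (auto simp: adjoin_0_def)
  have "finite (A - u)"
    using assms op u by (auto simp: locally_cofinite_at_0_def)
  moreover have "\<forall>x\<in>A - u. \<exists>v\<in>C. x \<in> v"
    using cov by (auto simp: adjoin_0_def)
  \<comment> \<open>The finite subcover is \<open>u\<close>, which takes care of 0 and of
    \<open>A \<inter> u\<close>, together with one chosen member \<open>f x\<close> for each of the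
    finitely many points \<open>x\<close> left over.\<close>
  then obtain f where "\<forall>x\<in>A - u. f x \<in> C \<and> x \<in> f x"
    by metis
  ultimately have "insert u (f ` (A - u)) \<subseteq> C \<and> finite (insert u (f ` (A - u)))
      \<and> adjoin_0 A \<subseteq> \<Union>(insert u (f ` (A - u)))"
    using u by (auto simp: adjoin_0_def)
  then show "\<exists>C'\<subseteq>C. finite C' \<and> adjoin_0 A \<subseteq> \<Union>C'"
    by blast
qed

lemma sumset'_0: "sumset' T 0 = {0}"
  by (auto simp: sumset'_def)

text \<open>Splitting off the last summand, on the right because the order matters, reduces the
  n-fold sum to a binary one, so that continuity of addition in two variables suffices.\<close>

lemma sumset'_Suc:
  "sumset' T (Suc n) = (\<lambda>(x, y). x + y) ` (sumset' T n \<times> adjoin_0 (T (Suc n)))"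
proof (intro subset_antisym subsetI)
  fix z assume "z \<in> sumset' T (Suc n)"
  then obtain a where "\<forall>i\<in>{1..Suc n}. a i \<in> adjoin_0 (T i)"
    and "z = sum_list (map a [1..<Suc n]) + a (Suc n)"
    by (auto simp: sumset'_def)
  then show "z \<in> (\<lambda>(x, y). x + y) ` (sumset' T n \<times> adjoin_0 (T (Suc n)))"
    by (force simp: sumset'_def)
next
  fix z assume "z \<in> (\<lambda>(x, y). x + y) ` (sumset' T n \<times> adjoin_0 (T (Suc n)))"
  then obtain a y where a: "\<forall>i\<in>{1..n}. a i \<in> adjoin_0 (T i)"
    and y: "y \<in> adjoin_0 (T (Suc n))" and z: "z = sum_list (map a [1..<Suc n]) + y"
    by (auto simp: sumset'_def)
  \<comment> \<open>The list \<open>[1..<Suc n]\<close> stops at \<open>n\<close>, so redefining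
    \<open>a\<close> at \<open>Suc n\<close> to append \<open>y\<close> leaves the earlier summands
    unchanged.\<close>
  have "map (a(Suc n := y)) [1..<Suc n] = map a [1..<Suc n]"
    by (rule map_cong) auto
  then have "z = sum_list (map (a(Suc n := y)) [1..<Suc (Suc n)])"
    by (simp add: z)
  moreover have "\<forall>i\<in>{1..Suc n}. (a(Suc n := y)) i \<in> adjoin_0 (T i)"
    using a y by auto
  ultimately show "z \<in> sumset' T (Suc n)"
    unfolding sumset'_def by blast
qed

theorem theorem2p1:
  fixes T :: "nat \<Rightarrow> 'a::{topological_group_add,t2_space} set"
    and n :: nat
  assumes "\<And>i. i \<ge> 1 \<Longrightarrow> locally_cofinite_at_0 (T i)"
    and "n > 0"
  shows "compact (sumset' T n)"
proof -
  \<comment> \<open>Starting at the empty sum makes the base case a singleton, and the first summand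
    is then added by the general step.\<close>
  have "compact (sumset' T m)" for m
  proof (induction m)
    case 0
    show ?case by (simp add: sumset'_0)
  next
    case (Suc m)
    have "continuous_on (sumset' T m \<times> adjoin_0 (T (Suc m))) (\<lambda>(x, y). x + y)"
      unfolding split_beta by (intro continuous_intros)
    \<comment> \<open>The hypothesis covers indices from 1 on, and \<open>Suc m\<close> is one of
      them.\<close>
    moreover have "compact (adjoin_0 (T (Suc m)))"
      by (simp add: assms(1) compact_adjoin_0)
    ultimately show ?case
      unfolding sumset'_Suc by (intro compact_continuous_image compact_Times Suc.IH)
  qed
  then show ?thesis .
qed

end
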